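(* Let $p,r\in\mathbb Z$ and let $q,s,m$ be positive integers with $q<s$ and $rq-ps=1$. Let $\vartheta$ be real with $p/q<\vartheta/(2\pi)<r/s$, put $A=q\vartheta-2\pi p$, $B=(2\pi r-s\vartheta)/m$, $e=s-mq$, and assume $A+B<\pi$. Let $\omega=\rho e^{i\vartheta}$ with $0<\rho<1$, let $\beta_1,\dots,\beta_m\in[0,1)$, and define, with arguments in $(0,\pi)$, $$u_j=\operatorname{Arg}(\omega^q-\beta_j),\qquad M=\operatorname{Arg}(\omega^q-1).$$ Suppose that $$\omega^e\prod_{j=1}^m(\omega^q-\beta_j)=\prod_{j=1}^m(1-\beta_j)\quad\text{(product relation)},\qquad e\vartheta+\sum_{j=1}^mu_j=2\pi(r-mp)\quad\text{(real argument identity)}.$$ The real argument identity gives $\bar u:=\frac1m\sum_{j=1}^mu_j=A+B$. Define $$F(u)=\log\sin M-\log\sin(M-u)\quad(0<u<M),\qquad J=\sum_{j=1}^mF(u_j)-mF(\bar u),$$ $$D_\rho=\sin(A+B)-\rho^{s/m}\sin A-\rho^q\sin B .$$ Then $$J\ge\frac12\sum_{j=1}^m(u_j-\bar u)^2,\qquad D_\rho=\rho^{s/m}\sin A\,\bigl(e^{J/m}-1\bigr),$$ where in the last formula $e$ denotes the base of natural logarithms. Consequently $$\sum_{j=1}^m(u_j-\bar u)^2\le2m\log\left(1+\frac{D_\rho}{\rho^{s/m}\sin A}\right)\le\frac{2mD_\rho}{\rho^{s/m}\sin A}.$$ Put $$\bar\beta=\frac1m\sum_{j=1}^m\beta_j,\qquad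 c_\rho=\frac{\rho^q\sin A}{(1+\rho^q)^2}>0.$$ Then $$\sum_{j=1}^m(\beta_j-\bar\beta)^2\le c_\rho^{-2}\sum_{j=1}^m(u_j-\bar u)^2.$$ Let $\rho_*$ be the unique solution in $(0,1)$ of $\rho_*^{s/m}\sin A+\rho_*^q\sin B=\sin(A+B)$. With $p/q$, $r/s$, the factor count $m$ and the angle $\vartheta$ fixed, both sums $\sum_j(u_j-\bar u)^2$ and $\sum_j(\beta_j-\bar\beta)^2$ are $O(\rho_*-\rho)$ as $\rho\to\rho_*$ from below, provided the coefficients continue to satisfy the product relation and the real argument identity. The constants are uniform as the angle varies over a compact subset of the open interval $(2\pi p/q,2\pi r/s)$ and $\rho$ stays bounded away from zero.
   Context: $\operatorname{Arg}$ denotes the principal argument; here $\omega^q=\rho^qe^{iA}$ lies in the open upper half-plane. Under the hypotheses one has $A\le u_j<M<\pi$, and $J\ge0$, $D_\rho\ge0$. As the angle varies, $A,B,\rho_*$ vary with it and all stated hypotheses (including $A+B<\pi$) are understood to hold. *)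

theory Defs
  imports "HOL-Analysis.Analysis" "HOL-Library.Landau_Symbols"
begin

definition angA :: "int \<Rightarrow> nat \<Rightarrow> real \<Rightarrow> real" where
  "angA p q \<theta> = real q * \<theta> - 2 * pi * real_of_int p"

definition angB :: "int \<Rightarrow> nat \<Rightarrow> nat \<Rightarrow> real \<Rightarrow> real" where
  "angB r s m \<theta> = (2 * pi * real_of_int r - real s * \<theta>) / real m"

text \<open>The exponent \<open>e = s - m q\<close> may be negative, hence is an integer.\<close>
definition exp_e :: "nat \<Rightarrow> nat \<Rightarrow> nat \<Rightarrow> int" where
  "exp_e q s m = int s - int m * int q"

definition admissible_angle :: "int \<Rightarrow> nat \<Rightarrow> int \<Rightarrow> nat \<Rightarrow> nat \<Rightarrow> real \<Rightarrow> bool" where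
  "admissible_angle p q r s m \<theta> \<longleftrightarrow>
     real_of_int p / real q < \<theta> / (2 * pi) \<and> \<theta> / (2 * pi) < real_of_int r / real s \<and>
     angA p q \<theta> + angB r s m \<theta> < pi"

text \<open>
  The point is \<open>\<omega> = rcis \<rho> \<theta>\<close>.  For an admissible angle, \<open>\<omega> ^ q\<close> lies in the open upper
  half-plane, so the principal arguments below automatically lie in \<open>(0, \<pi>)\<close>.
\<close>
definition u_arg :: "nat \<Rightarrow> real \<Rightarrow> real \<Rightarrow> real \<Rightarrow> real" where
  "u_arg q \<theta> \<rho> b = Arg (rcis \<rho> \<theta> ^ q - complex_of_real b)"

definition M_arg :: "nat \<Rightarrow> real \<Rightarrow> real \<Rightarrow> real" where
  "M_arg q \<theta> \<rho> = Arg (rcis \<rho> \<theta> ^ q - 1)"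

text \<open>Families indexed by \<open>1, \<dots>, m\<close> are functions on \<open>nat\<close>; values at other indices are ignored.\<close>

definition avg :: "nat \<Rightarrow> (nat \<Rightarrow> real) \<Rightarrow> real" where
  "avg m x = (\<Sum>j = 1..m. x j) / real m"

definition sqdev :: "nat \<Rightarrow> (nat \<Rightarrow> real) \<Rightarrow> real" where
  "sqdev m x = (\<Sum>j = 1..m. (x j - avg m x)\<^sup>2)"

definition product_relation :: "nat \<Rightarrow> nat \<Rightarrow> nat \<Rightarrow> real \<Rightarrow> real \<Rightarrow> (nat \<Rightarrow> real) \<Rightarrow> bool" where
  "product_relation q s m \<theta> \<rho> \<beta> \<longleftrightarrow>
     rcis \<rho> \<theta> powi exp_e q s m * (\<Prod>j = 1..m. rcis \<rho> \<theta> ^ q - complex_of_real (\<beta> j))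
       = complex_of_real (\<Prod>j = 1..m. 1 - \<beta> j)"

text \<open>This is an identity of real numbers, not merely modulo \<open>2 \<pi>\<close>.\<close>
definition argument_identity ::
    "int \<Rightarrow> nat \<Rightarrow> int \<Rightarrow> nat \<Rightarrow> nat \<Rightarrow> real \<Rightarrow> real \<Rightarrow> (nat \<Rightarrow> real) \<Rightarrow> bool" where
  "argument_identity p q r s m \<theta> \<rho> \<beta> \<longleftrightarrow>
     real_of_int (exp_e q s m) * \<theta> + (\<Sum>j = 1..m. u_arg q \<theta> \<rho> (\<beta> j))
       = 2 * pi * (real_of_int r - real m * real_of_int p)"

definition admissible ::
    "int \<Rightarrow> nat \<Rightarrow> int \<Rightarrow> nat \<Rightarrow> nat \<Rightarrow> real \<Rightarrow> real \<Rightarrow> (nat \<Rightarrow> real) \<Rightarrow> bool" where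
  "admissible p q r s m \<theta> \<rho> \<beta> \<longleftrightarrow>
     admissible_angle p q r s m \<theta> \<and> 0 < \<rho> \<and> \<rho> < 1 \<and>
     (\<forall>j \<in> {1..m}. 0 \<le> \<beta> j \<and> \<beta> j < 1) \<and>
     product_relation q s m \<theta> \<rho> \<beta> \<and> argument_identity p q r s m \<theta> \<rho> \<beta>"

definition F_fun :: "real \<Rightarrow> real \<Rightarrow> real" where
  "F_fun M u = ln (sin M) - ln (sin (M - u))"

definition J_gap :: "nat \<Rightarrow> nat \<Rightarrow> real \<Rightarrow> real \<Rightarrow> (nat \<Rightarrow> real) \<Rightarrow> real" where
  "J_gap q m \<theta> \<rho> \<beta> =
     (\<Sum>j = 1..m. F_fun (M_arg q \<theta> \<rho>) (u_arg q \<theta> \<rho> (\<beta> j)))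
       - real m * F_fun (M_arg q \<theta> \<rho>) (avg m (\<lambda>j. u_arg q \<theta> \<rho> (\<beta> j)))"

definition D_gap :: "int \<Rightarrow> nat \<Rightarrow> int \<Rightarrow> nat \<Rightarrow> nat \<Rightarrow> real \<Rightarrow> real \<Rightarrow> real" where
  "D_gap p q r s m \<theta> \<rho> =
     sin (angA p q \<theta> + angB r s m \<theta>)
       - \<rho> powr (real s / real m) * sin (angA p q \<theta>) - \<rho> ^ q * sin (angB r s m \<theta>)"

definition c_const :: "int \<Rightarrow> nat \<Rightarrow> real \<Rightarrow> real \<Rightarrow> real" where
  "c_const p q \<theta> \<rho> = \<rho> ^ q * sin (angA p q \<theta>) / (1 + \<rho> ^ q)\<^sup>2"

definition is_rho_star :: "int \<Rightarrow> nat \<Rightarrow> int \<Rightarrow> nat \<Rightarrow> nat \<Rightarrow> real \<Rightarrow> real \<Rightarrow> bool" where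
  "is_rho_star p q r s m \<theta> x \<longleftrightarrow>
     0 < x \<and> x < 1 \<and>
     x powr (real s / real m) * sin (angA p q \<theta>) + x ^ q * sin (angB r s m \<theta>)
       = sin (angA p q \<theta> + angB r s m \<theta>)"

definition rho_star :: "int \<Rightarrow> nat \<Rightarrow> int \<Rightarrow> nat \<Rightarrow> nat \<Rightarrow> real \<Rightarrow> real" where
  "rho_star p q r s m \<theta> = (THE x. is_rho_star p q r s m \<theta> x)"

text \<open>
  The filter of \<open>\<rho> \<rightarrow> \<rho>\<^sub>*\<close> from below at a fixed angle, over all admissible pairs \<open>(\<rho>, \<beta>)\<close>:
  a property holds eventually iff it holds for every admissible \<open>(\<rho>, \<beta>)\<close> with \<open>\<rho> < \<rho>\<^sub>*\<close>
  sufficiently close to \<open>\<rho>\<^sub>*\<close>, with no restriction on how \<open>\<beta>\<close> depends on \<open>\<rho>\<close>.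
\<close>
definition below_rho_star ::
    "int \<Rightarrow> nat \<Rightarrow> int \<Rightarrow> nat \<Rightarrow> nat \<Rightarrow> real \<Rightarrow> (real \<times> (nat \<Rightarrow> real)) filter" where
  "below_rho_star p q r s m \<theta> =
     inf (filtercomap fst (at_left (rho_star p q r s m \<theta>)))
         (principal {(\<rho>, \<beta>). admissible p q r s m \<theta> \<rho> \<beta>})"

end

theory Submission
  imports Defs
begin

text \<open>
  Write \<open>w = \<omega> ^ q\<close>. The sine formula
  \<open>sin (Arg (w - b) - Arg (w - a)) = Im w * (b - a) / (\<bar>w - a\<bar> * \<bar>w - b\<bar>)\<close> for real \<open>a, b\<close> drives
  everything. With \<open>b = 1\<close> it gives \<open>F u\<^sub>j = ln \<bar>w - \<beta>\<^sub>j\<bar> - ln (1 - \<beta>\<^sub>j)\<close>, so that the modulus of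
  the product relation evaluates \<open>\<Sum> F u\<^sub>j\<close>; the value \<open>F (A + B)\<close> is explicit, and the formula for
  \<open>D\<close> follows. Since \<open>F'' = 1 / sin\<^sup>2 \<ge> 1\<close>, Jensen's inequality for \<open>F u - u\<^sup>2 / 2\<close> bounds \<open>J\<close> from
  below. The same sine formula shows that \<open>\<beta>\<^sub>j\<close> is a Lipschitz function of \<open>u\<^sub>j\<close>, and \<open>D\<close> is
  \<open>O(\<rho>\<^sub>* - \<rho>)\<close> because it vanishes at \<open>\<rho>\<^sub>*\<close> and is Lipschitz in \<open>\<rho>\<close> away from zero.
\<close>

section \<open>Square deviations and the convexity bound for \<open>F_fun\<close>\<close>

lemma sqdev_altdef:
  assumes "0 < m"
  shows "sqdev m x = (\<Sum>j = 1..m. (x j)\<^sup>2) - real m * (avg m x)\<^sup>2"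
proof -
  have S: "(\<Sum>j = 1..m. x j) = real m * avg m x"
    using assms by (simp add: avg_def)
  have "sqdev m x = (\<Sum>j = 1..m. (x j)\<^sup>2) + real m * (avg m x)\<^sup>2 - 2 * avg m x * (\<Sum>j = 1..m. x j)"
    by (simp add: sqdev_def power2_diff sum.distrib sum_subtractf sum_distrib_left mult.assoc
        mult.commute mult.left_commute)
  then show ?thesis
    unfolding S by (simp add: power2_eq_square)
qed

text \<open>The mean disappears from the pairwise form, so a Lipschitz bound on differences passes
  to square deviations without comparing the two averages.\<close>

lemma sqdev_pairs:
  assumes "0 < m"
  shows "2 * real m * sqdev m x = (\<Sum>i = 1..m. \<Sum>j = 1..m. (x i - x j)\<^sup>2)"
proof -
  have S: "(\<Sum>j = 1..m. x j) = real m * avg m x"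
    using assms by (simp add: avg_def)
  have "(\<Sum>j = 1..m. (x i - x j)\<^sup>2)
      = real m * (x i)\<^sup>2 + (\<Sum>j = 1..m. (x j)\<^sup>2) - x i * (2 * real m * avg m x)" for i
    by (simp add: power2_diff sum.distrib sum_subtractf sum_distrib_left[symmetric] S del: One_nat_def)
  then have "(\<Sum>i = 1..m. \<Sum>j = 1..m. (x i - x j)\<^sup>2)
      = (\<Sum>i = 1..m. real m * (x i)\<^sup>2 + (\<Sum>j = 1..m. (x j)\<^sup>2) - x i * (2 * real m * avg m x))"
    by (simp only:)
  also have "\<dots> = 2 * real m * (\<Sum>j = 1..m. (x j)\<^sup>2) - (\<Sum>i = 1..m. x i) * (2 * real m * avg m x)"
    by (simp only: sum_subtractf sum.distrib sum_distrib_left[symmetric] sum_distrib_right[symmetric])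
       simp
  finally show ?thesis
    unfolding sqdev_altdef[OF assms] S by (simp add: power2_eq_square algebra_simps)
qed

lemma sqdev_nonneg: "0 \<le> sqdev m x"
  by (simp add: sqdev_def sum_nonneg)

lemma sqdev_lipschitz:
  assumes "0 < m"
    and "\<And>i j. i \<in> {1..m} \<Longrightarrow> j \<in> {1..m} \<Longrightarrow> \<bar>x i - x j\<bar> \<le> L * \<bar>y i - y j\<bar>"
  shows "sqdev m x \<le> L\<^sup>2 * sqdev m y"
proof -
  have "(x i - x j)\<^sup>2 \<le> L\<^sup>2 * (y i - y j)\<^sup>2" if "i \<in> {1..m}" "j \<in> {1..m}" for i j
    using power_mono[OF assms(2)[OF that], of 2] by (simp add: power_mult_distrib)
  then have "(\<Sum>i = 1..m. \<Sum>j = 1..m. (x i - x j)\<^sup>2)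
      \<le> (\<Sum>i = 1..m. \<Sum>j = 1..m. L\<^sup>2 * (y i - y j)\<^sup>2)"
    by (intro sum_mono) blast
  then have "2 * real m * sqdev m x \<le> 2 * real m * (L\<^sup>2 * sqdev m y)"
    unfolding sum_distrib_left[symmetric] sqdev_pairs[OF assms(1), symmetric]
    by (simp add: mult.left_commute)
  then show ?thesis
    using assms(1) by simp
qed

lemma F_fun_jensen:
  assumes "0 < m" and "M \<le> pi" and u: "\<And>j. j \<in> {1..m} \<Longrightarrow> 0 < u j \<and> u j < M"
  shows "1 / 2 * sqdev m u \<le> (\<Sum>j = 1..m. F_fun M (u j)) - real m * F_fun M (avg m u)"
proof -
  define H where "H x = F_fun M x - x\<^sup>2 / 2" for x
  have "convex_on {0<..<M} H"
  proof (rule f''_ge0_imp_convex)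
    fix x assume "x \<in> {0<..<M}"
    then have pos: "0 < sin (M - x)"
      using \<open>M \<le> pi\<close> by (intro sin_gt_zero) auto
    \<comment> \<open>The first derivative of F is cot (M - x). The bound \<open>M \<le> pi\<close>
      keeps M - x inside (0, pi), so the sine in the denominator is positive.\<close>
    show "(H has_real_derivative cos (M - x) / sin (M - x) - x) (at x)"
      unfolding H_def F_fun_def using pos by (auto intro!: derivative_eq_intros)
    have "((\<lambda>x. cos (M - x) / sin (M - x) - x) has_real_derivative
        (sin (M - x) * sin (M - x) + cos (M - x) * cos (M - x)) / (sin (M - x) * sin (M - x)) - 1) (at x)"
      using pos by (auto intro!: derivative_eq_intros)
    then show "((\<lambda>x. cos (M - x) / sin (M - x) - x) has_real_derivative
        1 / (sin (M - x))\<^sup>2 - 1) (at x)"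
      using sin_cos_squared_add[of "M - x"] by (simp add: power2_eq_square)
    have "(sin (M - x))\<^sup>2 \<le> 1"
      by (simp add: abs_square_le_1)
    then show "0 \<le> 1 / (sin (M - x))\<^sup>2 - 1"
      using pos by simp
  qed simp
  then have "H (\<Sum>j = 1..m. (1 / real m) *\<^sub>R u j) \<le> (\<Sum>j = 1..m. (1 / real m) * H (u j))"
    using assms by (intro convex_on_sum) auto
  then have "H (avg m u) \<le> (\<Sum>j = 1..m. H (u j)) / real m"
    by (simp add: avg_def sum_divide_distrib)
  then have "real m * H (avg m u) \<le> (\<Sum>j = 1..m. H (u j))"
    using \<open>0 < m\<close> by (simp add: field_simps)
  then show ?thesis
    \<comment> \<open>The quadratic parts of H collect into (sum of squares - m times squared mean)
      / 2, which is half the square deviation.\<close>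
    unfolding sqdev_altdef[OF \<open>0 < m\<close>] H_def
    by (simp add: sum_subtractf sum_divide_distrib[symmetric] algebra_simps)
qed

section \<open>Arguments of w - b for real b\<close>

lemma sin_Arg_diff:
  fixes a b :: real
  assumes "0 < Im w"
  shows "sin (Arg (w - b) - Arg (w - a)) = Im w * (b - a) / (cmod (w - a) * cmod (w - b))"
proof -
  have nz: "w - complex_of_real c \<noteq> 0" for c
    using assms by (auto simp: complex_eq_iff)
  \<comment> \<open>By the addition formula the numerator is Im w (Re w - a) - (Re w - b) Im w, in
    which Re w cancels.\<close>
  show ?thesis
    by (simp add: sin_diff sin_Arg[OF nz] cos_Arg[OF nz] diff_divide_distrib[symmetric]
        right_diff_distrib mult.commute)
qed

text \<open>Both arguments lie in (0, pi), so their difference lies in (-pi, pi), where the sine has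
  the sign of its argument; \<open>sin_Arg_diff\<close> gives that sign.\<close>

lemma Arg_diff_real_less_iff:
  fixes a b :: real
  assumes "0 < Im w"
  shows "Arg (w - a) < Arg (w - b) \<longleftrightarrow> a < b"
proof -
  have nz: "0 < cmod (w - complex_of_real c)" for c
    using assms by (auto simp: complex_eq_iff)
  have *: "Arg (w - complex_of_real a) < Arg (w - complex_of_real b)" if "a < b" for a b
  proof (rule ccontr)
    assume "\<not> ?thesis"
    moreover have "0 < Arg (w - complex_of_real b)" "Arg (w - complex_of_real a) < pi"
      using assms Arg_lt_pi[of "w - complex_of_real b"] Arg_lt_pi[of "w - complex_of_real a"] by auto
    ultimately have "0 \<le> sin (Arg (w - complex_of_real a) - Arg (w - complex_of_real b))"
      by (intro sin_ge_zero) auto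
    moreover have "Im w * (a - b) / (cmod (w - b) * cmod (w - a)) < 0"
      using assms nz that by (intro divide_neg_pos mult_pos_neg mult_pos_pos) auto
    ultimately show False
      using sin_Arg_diff[OF assms, of a b] by simp
  qed
  show ?thesis
    using *[of a b] *[of b a] by (cases a b rule: linorder_cases) auto
qed

text \<open>Solve \<open>sin_Arg_diff\<close> for b - a, then use |sin x| \<le> |x| and bound each
  of the two moduli by 1 + |w|.\<close>

lemma abs_diff_le_Arg_diff:
  fixes a b :: real
  assumes "0 < Im w" and "a \<in> {0..1}" and "b \<in> {0..1}"
  shows "\<bar>b - a\<bar> \<le> (1 + cmod w)\<^sup>2 / Im w * \<bar>Arg (w - b) - Arg (w - a)\<bar>"
proof -
  have nz: "cmod (w - complex_of_real c) \<noteq> 0" for c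
    using assms(1) by (auto simp: complex_eq_iff)
  have le: "cmod (w - complex_of_real c) \<le> 1 + cmod w" if "c \<in> {0..1}" for c
    using norm_triangle_ineq4[of w "complex_of_real c"] that by simp
  have "b - a = cmod (w - a) * cmod (w - b) / Im w * sin (Arg (w - b) - Arg (w - a))"
    unfolding sin_Arg_diff[OF assms(1)] using assms(1) nz by simp
  also have "\<bar>\<dots>\<bar> = cmod (w - a) * cmod (w - b) / Im w * \<bar>sin (Arg (w - b) - Arg (w - a))\<bar>"
    using assms(1) by (simp add: abs_mult)
  also have "\<dots> \<le> (1 + cmod w)\<^sup>2 / Im w * \<bar>Arg (w - b) - Arg (w - a)\<bar>"
    unfolding power2_eq_square using assms le
    by (intro mult_mono divide_right_mono abs_sin_x_le_abs_x) auto
  finally show ?thesis .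
qed

section \<open>Lipschitz bounds for powers\<close>

lemma powr_diff_le:
  fixes x y a x0 :: real
  assumes "0 < x0" "x0 \<le> x" "x < y" "y \<le> 1" "0 \<le> a"
  shows "y powr a - x powr a \<le> a / x0 * (y - x)"
proof -
  have "\<exists>z. x < z \<and> z < y \<and> y powr a - x powr a = (y - x) * (a * z powr (a - 1))"
    using assms by (intro MVT2) (auto intro!: derivative_eq_intros)
  then obtain z where z: "x < z" "z < y" and eq: "y powr a - x powr a = (y - x) * (a * z powr (a - 1))"
    by blast
  \<comment> \<open>The exponent a - 1 may have either sign. Splitting off 1 / z leaves a power that
    is at most 1, which treats both signs at once.\<close>
  have "z powr (a - 1) = z powr a / z"
    using z assms by (simp add: powr_diff)
  also have "\<dots> \<le> 1 / x0"
    using z assms by (intro frac_le powr_le1) auto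
  finally have "a * z powr (a - 1) \<le> a / x0"
    using mult_left_mono[OF _ assms(5)] by fastforce
  then show ?thesis
    unfolding eq mult.commute[of "a / x0"] using assms(3) by (intro mult_left_mono) auto
qed

lemma power_diff_le:
  fixes x y :: real
  assumes "0 \<le> x" "x \<le> y" "y \<le> 1"
  shows "y ^ n - x ^ n \<le> real n * (y - x)"
proof (induction n)
  case (Suc n)
  have "y ^ Suc n - x ^ Suc n = y * (y ^ n - x ^ n) + (y - x) * x ^ n"
    by (simp add: algebra_simps)
  also have "\<dots> \<le> 1 * (y ^ n - x ^ n) + (y - x) * 1"
    using assms by (intro add_mono mult_mono) (auto intro: power_mono power_le_one)
  finally show ?case
    using Suc by (simp add: algebra_simps)
qed simp

section \<open>The angles A and B and the critical radius\<close>

lemma rcis_power_angA: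
  "rcis \<rho> \<theta> ^ q = rcis (\<rho> ^ q) (angA p q \<theta>)"
proof -
  have "cis (real q * \<theta>) = cis (angA p q \<theta> + 2 * pi * real_of_int p)"
    by (simp add: angA_def)
  also have "\<dots> = cis (angA p q \<theta>)"
    by (simp add: cis_mult[symmetric])
  finally show ?thesis
    unfolding DeMoivre2 by (simp add: rcis_def)
qed

text \<open>Both cosines in the addition formula are below 1. This keeps the root
  \<open>rho_star\<close> strictly below 1.\<close>

lemma sin_add_less:
  fixes a b :: real
  assumes "0 < a" "0 < b" "a + b < pi"
  shows "sin (a + b) < sin a + sin b"
proof -
  have pos: "0 < sin a" "0 < sin b"
    using assms by (auto intro!: sin_gt_zero)
  have "cos x < 1" if "0 < x" "x < pi" for x
    using cos_monotone_0_pi[of 0 x] that by simp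
  then have "sin a * cos b < sin a * 1" "cos a * sin b < 1 * sin b"
    using assms pos by (intro mult_strict_left_mono mult_strict_right_mono; simp)+
  then show ?thesis
    by (simp add: sin_add)
qed

lemma admissible_angle_bounds:
  assumes "0 < q" "0 < s" "0 < m" and "admissible_angle p q r s m \<theta>"
  shows "0 < angA p q \<theta>" "0 < angB r s m \<theta>" "angA p q \<theta> + angB r s m \<theta> < pi"
proof -
  have "real_of_int p / real q < \<theta> / (2 * pi)" "\<theta> / (2 * pi) < real_of_int r / real s"
    using assms(4) by (auto simp: admissible_angle_def)
  then have "real_of_int p * (2 * pi) < \<theta> * real q" "\<theta> * real s < real_of_int r * (2 * pi)"
    using assms(1,2) by (simp_all add: divide_less_eq less_divide_eq)
  then show "0 < angA p q \<theta>" "0 < angB r s m \<theta>"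
    using assms(3) by (simp_all add: angA_def angB_def mult.commute mult.left_commute)
  show "angA p q \<theta> + angB r s m \<theta> < pi"
    using assms(4) by (simp add: admissible_angle_def)
qed

text \<open>The left side G of the defining equation increases strictly from 0 at 0 to sin A + sin B
  > sin (A + B) at 1, so the intermediate value theorem gives a root and monotonicity makes it
  unique.\<close>

lemma ex1_is_rho_star:
  assumes "0 < q" "0 < s" "0 < m" and "admissible_angle p q r s m \<theta>"
  shows "\<exists>!x. is_rho_star p q r s m \<theta> x"
proof -
  define A B where "A = angA p q \<theta>" and "B = angB r s m \<theta>"
  note AB = admissible_angle_bounds[OF assms, folded A_def B_def]
  have pos: "0 < sin A" "0 < sin B" "0 < sin (A + B)"
    using AB by (auto intro!: sin_gt_zero)
  define k where "k = real s / real m"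
  have "0 < k"
    using assms by (simp add: k_def)
  define G where "G x = x powr k * sin A + x ^ q * sin B" for x :: real
  have star: "is_rho_star p q r s m \<theta> x \<longleftrightarrow> 0 < x \<and> x < 1 \<and> G x = sin (A + B)" for x
    by (simp add: is_rho_star_def G_def A_def B_def k_def)
  have mono: "G x < G y" if "0 \<le> x" "x < y" for x y
    unfolding G_def using that pos \<open>0 < k\<close> \<open>0 < q\<close>
    by (intro add_strict_mono mult_strict_right_mono powr_less_mono2 power_strict_mono) auto
  \<comment> \<open>The value \<open>0 powr k = 0\<close> is a convention; it agrees with the limit
    at 0 because \<open>0 < k\<close>, so G is continuous up to 0.\<close>
  have G0: "G 0 = 0" and G1: "G 1 = sin A + sin B"
    using \<open>0 < q\<close> by (auto simp: G_def)
  have "continuous_on {0..1} G"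
    unfolding G_def using \<open>0 < k\<close>
    by (intro continuous_intros continuous_on_powr') auto
  moreover have "sin (A + B) < G 1"
    using AB by (simp add: G1 sin_add_less)
  ultimately obtain x where x: "0 \<le> x" "x \<le> 1" "G x = sin (A + B)"
    using IVT'[of G 0 "sin (A + B)" 1] pos G0 by auto
  have "x \<noteq> 0" "x \<noteq> 1"
    using x(3) pos G0 \<open>sin (A + B) < G 1\<close> by auto
  with x have "is_rho_star p q r s m \<theta> x"
    by (simp add: star)
  moreover have "y = x" if "is_rho_star p q r s m \<theta> y" for y
    using that x(1,3) mono[of x y] mono[of y x] unfolding star
    by (cases x y rule: linorder_cases) auto
  ultimately show ?thesis
    by blast
qed

lemma is_rho_star_rho_star:
  assumes "0 < q" "0 < s" "0 < m" and "admissible_angle p q r s m \<theta>"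
  shows "is_rho_star p q r s m \<theta> (rho_star p q r s m \<theta>)"
  unfolding rho_star_def by (rule theI') (rule ex1_is_rho_star[OF assms])

text \<open>Inserting the equation for x writes D as a difference of powers at x and \<rho>,
  weighted by sin A and sin B. Bounding both sines by 1 makes the constant independent of the
  angle.\<close>

lemma D_gap_le:
  assumes "0 < m" and star: "is_rho_star p q r s m \<theta> x"
    and "0 < \<rho>0" "\<rho>0 \<le> \<rho>" "\<rho> < x"
  shows "D_gap p q r s m \<theta> \<rho> \<le> (real s / (real m * \<rho>0) + real q) * (x - \<rho>)"
proof -
  define A B where "A = angA p q \<theta>" and "B = angB r s m \<theta>"
  define k where "k = real s / real m"
  have x: "x < 1" "sin (A + B) = x powr k * sin A + x ^ q * sin B"
    using star by (auto simp: is_rho_star_def A_def B_def k_def)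
  have P: "0 \<le> x powr k - \<rho> powr k" "0 \<le> x ^ q - \<rho> ^ q"
    using assms by (auto simp: k_def intro!: powr_mono2 power_mono)
  have "D_gap p q r s m \<theta> \<rho> = (x powr k - \<rho> powr k) * sin A + (x ^ q - \<rho> ^ q) * sin B"
    by (simp add: D_gap_def A_def[symmetric] B_def[symmetric] k_def[symmetric] x(2) algebra_simps)
  also have "\<dots> \<le> (x powr k - \<rho> powr k) * 1 + (x ^ q - \<rho> ^ q) * 1"
    using P by (intro add_mono mult_left_mono) auto
  also have "\<dots> \<le> k / \<rho>0 * (x - \<rho>) + real q * (x - \<rho>)"
    using powr_diff_le[of \<rho>0 \<rho> x k] power_diff_le[of \<rho> x q] assms x(1) by (simp add: k_def)
  also have "\<dots> = (real s / (real m * \<rho>0) + real q) * (x - \<rho>)"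
    by (simp add: k_def algebra_simps)
  finally show ?thesis .
qed

section \<open>Exact formulas and estimates at one admissible point\<close>

locale admissible_point =
  fixes p r :: int and q s m :: nat and \<theta> \<rho> :: real and \<beta> :: "nat \<Rightarrow> real"
  assumes q: "0 < q" and s: "0 < s" and m: "0 < m"
    and adm: "admissible p q r s m \<theta> \<rho> \<beta>"
begin

abbreviation "A \<equiv> angA p q \<theta>"
abbreviation "B \<equiv> angB r s m \<theta>"
abbreviation "M \<equiv> M_arg q \<theta> \<rho>"
abbreviation "u \<equiv> \<lambda>j. u_arg q \<theta> \<rho> (\<beta> j)"
abbreviation "J \<equiv> J_gap q m \<theta> \<rho> \<beta>"
abbreviation "D \<equiv> D_gap p q r s m \<theta> \<rho>"
abbreviation "R \<equiv> \<rho> powr (real s / real m)"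
abbreviation "w \<equiv> rcis \<rho> \<theta> ^ q"

lemma rho: "0 < \<rho>" "\<rho> < 1"
  and beta: "j \<in> {1..m} \<Longrightarrow> 0 \<le> \<beta> j \<and> \<beta> j < 1"
  and angle: "admissible_angle p q r s m \<theta>"
  using adm by (auto simp: admissible_def)

lemmas angle_bounds = admissible_angle_bounds[OF q s m angle]

lemma sin_A: "0 < sin A"
  using angle_bounds by (auto intro!: sin_gt_zero)

lemma Re_w: "Re w = \<rho> ^ q * cos A" and Im_w: "Im w = \<rho> ^ q * sin A" and norm_w: "cmod w = \<rho> ^ q"
  using rho by (simp_all add: rcis_power_angA[of _ _ _ p])

lemma Im_w_pos: "0 < Im w"
  using rho sin_A by (simp add: Im_w)

lemma norm_pos: "0 < cmod (w - complex_of_real b)"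
  using Im_w_pos by (auto simp: complex_eq_iff)

lemma Arg_w: "Arg w = A"
proof (rule Arg_unique)
  show "complex_of_real (\<rho> ^ q) * exp (\<i> * complex_of_real A) = w"
    unfolding rcis_power_angA[of _ _ _ p] by (simp add: rcis_def cis_conv_exp)
qed (use rho angle_bounds in auto)

lemma M_bounds: "0 < M" "M < pi"
  using Im_w_pos Arg_lt_pi[of "w - 1"] by (auto simp: M_arg_def)

lemma u_bounds:
  assumes "j \<in> {1..m}"
  shows "0 < u j" "A \<le> u j" "u j < M"
proof -
  show "A \<le> u j"
    \<comment> \<open>The comparison with A = Arg w is strict, so \<beta> j = 0, where equality
      holds, is treated separately.\<close>
    using Arg_diff_real_less_iff[OF Im_w_pos, of 0 "\<beta> j"] beta[OF assms]
    by (cases "\<beta> j = 0") (auto simp: u_arg_def Arg_w)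
  then show "0 < u j"
    using angle_bounds by simp
  show "u j < M"
    using Arg_diff_real_less_iff[OF Im_w_pos, of "\<beta> j" 1] beta[OF assms]
    by (simp add: u_arg_def M_arg_def)
qed

text \<open>With e = s - m q the argument identity makes the sum of the u j equal to m (q \<theta> -
  2 pi p) + (2 pi r - s \<theta>). An identity modulo 2 pi would fix the mean only modulo 2 pi /
  m.\<close>

lemma avg_u: "avg m u = A + B"
proof -
  have "real m * B = 2 * pi * real_of_int r - real s * \<theta>"
    using m by (simp add: angB_def)
  then have "real m * (A + B) = (\<Sum>j = 1..m. u j)"
    using adm by (simp add: admissible_def argument_identity_def exp_e_def angA_def algebra_simps)
  then show ?thesis
    using m by (simp add: avg_def field_simps)
qed

lemma F_fun_u:
  assumes "j \<in> {1..m}"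
  shows "F_fun M (u j) = ln (cmod (w - \<beta> j)) - ln (1 - \<beta> j)"
proof -
  have nz: "w - 1 \<noteq> 0"
    using norm_pos[of 1] by auto
  have "sin (M - u j) = Im w * (1 - \<beta> j) / (cmod (w - \<beta> j) * cmod (w - 1))"
    using sin_Arg_diff[OF Im_w_pos, of 1 "\<beta> j"] by (simp add: M_arg_def u_arg_def)
  moreover have "sin M = Im w / cmod (w - 1)"
    using sin_Arg[OF nz] by (simp add: M_arg_def)
  ultimately show ?thesis
    using Im_w_pos norm_pos[of "\<beta> j"] norm_pos[of 1] beta[OF assms]
    by (simp add: F_fun_def ln_div ln_mult)
qed

text \<open>Take logarithms of the moduli in the product relation. The angular information enters
  separately, through \<open>avg_u\<close>.\<close>

lemma sum_F_fun: "(\<Sum>j = 1..m. F_fun M (u j)) = - real_of_int (exp_e q s m) * ln \<rho>"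
proof -
  have "cmod (rcis \<rho> \<theta> powi exp_e q s m * (\<Prod>j = 1..m. w - complex_of_real (\<beta> j)))
      = cmod (complex_of_real (\<Prod>j = 1..m. 1 - \<beta> j))"
    using adm by (simp add: admissible_def product_relation_def)
  moreover have "0 \<le> (\<Prod>j = 1..m. 1 - \<beta> j)"
    by (intro prod_nonneg) (use beta in force)
  ultimately have "\<rho> powi exp_e q s m * (\<Prod>j = 1..m. cmod (w - \<beta> j)) = (\<Prod>j = 1..m. 1 - \<beta> j)"
    using rho by (simp add: norm_mult norm_power_int prod_norm del: of_real_prod)
  \<comment> \<open>The integer power becomes a real power so that \<open>ln_powr\<close> covers a
    negative exponent too.\<close>
  then have "ln (\<rho> powr real_of_int (exp_e q s m) * (\<Prod>j = 1..m. cmod (w - \<beta> j)))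
      = ln (\<Prod>j = 1..m. 1 - \<beta> j)"
    using rho by (simp add: powr_real_of_int')
  moreover have "ln (\<Prod>j = 1..m. cmod (w - \<beta> j)) = (\<Sum>j = 1..m. ln (cmod (w - \<beta> j)))"
    using norm_pos by (intro ln_prod) (auto simp: less_le)
  moreover have "ln (\<Prod>j = 1..m. 1 - \<beta> j) = (\<Sum>j = 1..m. ln (1 - \<beta> j))"
    using beta by (intro ln_prod) force+
  moreover have "0 < (\<Prod>j = 1..m. cmod (w - \<beta> j))"
    using norm_pos by (intro prod_pos) auto
  moreover have "0 < \<rho> powr real_of_int (exp_e q s m)"
    using rho by simp
  ultimately have "real_of_int (exp_e q s m) * ln \<rho> + (\<Sum>j = 1..m. ln (cmod (w - \<beta> j)))
      = (\<Sum>j = 1..m. ln (1 - \<beta> j))"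
    using ln_mult_pos[of "\<rho> powr real_of_int (exp_e q s m)"] by (simp only: ln_powr)
  then show ?thesis
    by (simp add: F_fun_u sum_subtractf)
qed

text \<open>This makes sin (M - (A + B)) positive, so the logarithm in F at the mean can be undone
  by exp.\<close>

lemma avg_u_less_M: "A + B < M"
proof -
  have "(\<Sum>j = 1..m. u j) < (\<Sum>j = 1..m. M)"
    using u_bounds m by (intro sum_strict_mono) auto
  then have "avg m u < M"
    using m by (simp add: avg_def divide_less_eq mult.commute)
  then show ?thesis
    by (simp add: avg_u)
qed

text \<open>The left side is sin (M - (A + B)) / sin M. Expanding it leaves only cot M = (Re w - 1)
  / Im w, which eliminates M; B enters through sin B = sin ((A + B) - A).\<close>

lemma exp_neg_F_fun_avg:
  "exp (- F_fun M (A + B)) = (sin (A + B) - \<rho> ^ q * sin B) / (\<rho> ^ q * sin A)"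
proof -
  have nz: "w - 1 \<noteq> 0"
    using norm_pos[of 1] by auto
  have s: "sin M = Im w / cmod (w - 1)" and c: "cos M = (Re w - 1) / cmod (w - 1)"
    using sin_Arg[OF nz] cos_Arg[OF nz] by (simp_all add: M_arg_def)
  have pos: "0 < sin M" "0 < sin (M - (A + B))"
    using M_bounds avg_u_less_M angle_bounds by (auto intro!: sin_gt_zero)
  have sB: "sin B = sin (A + B) * cos A - cos (A + B) * sin A"
    using sin_diff[of "A + B" A] by simp
  have "exp (- F_fun M (A + B)) = sin (M - (A + B)) / sin M"
    using pos by (simp add: F_fun_def exp_diff)
  also have "\<dots> = (Im w * cos (A + B) - (Re w - 1) * sin (A + B)) / Im w"
    unfolding sin_diff[of M] s c using norm_pos[of 1] by (simp add: diff_divide_distrib[symmetric])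
  also have "\<dots> = (sin (A + B) - \<rho> ^ q * sin B) / (\<rho> ^ q * sin A)"
    unfolding sB Re_w Im_w by (simp add: algebra_simps)
  finally show ?thesis .
qed

lemma J_ge: "1 / 2 * sqdev m u \<le> J"
  unfolding J_gap_def using m M_bounds u_bounds by (intro F_fun_jensen) auto

text \<open>Since -e / m = q - s / m, the sum of the F values contributes \<rho>^q / R, and \<rho>^q
  cancels against the denominator in \<open>exp_neg_F_fun_avg\<close>. Subtracting 1 and clearing
  the denominator then gives D.\<close>

lemma exp_J: "exp (J / real m) = (sin (A + B) - \<rho> ^ q * sin B) / (R * sin A)"
proof -
  have "J / real m = - real_of_int (exp_e q s m) / real m * ln \<rho> - F_fun M (A + B)"
    unfolding J_gap_def sum_F_fun avg_u using m by (simp add: field_simps)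
  also have "- real_of_int (exp_e q s m) / real m * ln \<rho> = real q * ln \<rho> - real s / real m * ln \<rho>"
    using m by (simp add: exp_e_def field_simps)
  finally have "exp (J / real m)
      = exp (real q * ln \<rho>) / exp (real s / real m * ln \<rho>) * exp (- F_fun M (A + B))"
    by (simp add: exp_diff exp_minus divide_inverse)
  moreover have "exp (real q * ln \<rho>) = \<rho> ^ q" "exp (real s / real m * ln \<rho>) = R"
    using rho by (auto simp: exp_of_nat_mult powr_def)
  ultimately show ?thesis
    unfolding exp_neg_F_fun_avg using rho by simp
qed

lemma R_sin_A_pos: "0 < R * sin A"
  using rho sin_A by simp

lemma D_eq: "D = R * sin A * (exp (J / real m) - 1)"
  unfolding exp_J right_diff_distrib using rho sin_A by (simp add: D_gap_def)

lemma J_nonneg: "0 \<le> J"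
  using J_ge sqdev_nonneg[of m u] by linarith

text \<open>D inherits its sign from J. As the left side of the equation for \<open>rho_star\<close>
  increases in the radius, admissible radii never exceed \<open>rho_star\<close>.\<close>

lemma D_nonneg: "0 \<le> D"
  unfolding D_eq using J_nonneg by (intro mult_nonneg_nonneg[OF less_imp_le[OF R_sin_A_pos]]) simp

lemma ln_D: "ln (1 + D / (R * sin A)) = J / real m"
proof -
  have "1 + D / (R * sin A) = exp (J / real m)"
    unfolding D_eq using rho sin_A by simp
  then show ?thesis
    by simp
qed

lemma sqdev_u_le_ln: "sqdev m u \<le> 2 * real m * ln (1 + D / (R * sin A))"
  unfolding ln_D using J_ge m by simp

lemma ln_D_le: "2 * real m * ln (1 + D / (R * sin A)) \<le> 2 * real m * D / (R * sin A)"
proof -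
  have "0 \<le> D / (R * sin A)"
    using D_nonneg R_sin_A_pos by (intro divide_nonneg_pos)
  then have "2 * real m * ln (1 + D / (R * sin A)) \<le> 2 * real m * (D / (R * sin A))"
    by (intro mult_left_mono ln_add_one_self_le_self) auto
  then show ?thesis
    by simp
qed

lemma c_const_pos: "0 < c_const p q \<theta> \<rho>"
  unfolding c_const_def using rho sin_A
  by (intro divide_pos_pos mult_pos_pos zero_less_power) (auto simp: add_pos_pos)

lemma sqdev_beta_le: "sqdev m \<beta> \<le> sqdev m u / (c_const p q \<theta> \<rho>)\<^sup>2"
proof -
  have "sqdev m \<beta> \<le> ((1 + cmod w)\<^sup>2 / Im w)\<^sup>2 * sqdev m u"
  proof (rule sqdev_lipschitz[OF m])
    fix i j assume "i \<in> {1..m}" "j \<in> {1..m}"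
    then show "\<bar>\<beta> i - \<beta> j\<bar> \<le> (1 + cmod w)\<^sup>2 / Im w * \<bar>u i - u j\<bar>"
      unfolding u_arg_def using Im_w_pos beta[of i] beta[of j] by (intro abs_diff_le_Arg_diff) auto
  qed
  \<comment> \<open>Here |w| = \<rho>^q and Im w = \<rho>^q sin A, so the Lipschitz constant is
    exactly 1 / c.\<close>
  also have "(1 + cmod w)\<^sup>2 / Im w = 1 / c_const p q \<theta> \<rho>"
    by (simp only: norm_w Im_w c_const_def) simp
  finally show ?thesis
    by (simp add: power_divide)
qed

text \<open>The numerator is controlled by \<open>D_gap_le\<close>; in the denominators \<rho> and
  sin A are replaced by their lower bounds \<open>\<rho>0\<close> and a. The resulting constants
  depend neither on \<theta> nor on \<rho>.\<close>

lemma sqdev_uniform: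
  fixes \<rho>0 a :: real
  defines "C \<equiv> 2 * real m * (real s / (real m * \<rho>0) + real q) / (\<rho>0 powr (real s / real m) * a)"
  assumes "0 < \<rho>0" "\<rho>0 \<le> \<rho>" "\<rho> < rho_star p q r s m \<theta>" "0 < a" "a \<le> sin A"
  shows "sqdev m u \<le> C * (rho_star p q r s m \<theta> - \<rho>)"
    and "sqdev m \<beta> \<le> C / (\<rho>0 ^ q * a / 4)\<^sup>2 * (rho_star p q r s m \<theta> - \<rho>)"
proof -
  let ?d = "rho_star p q r s m \<theta> - \<rho>"
  have "sqdev m u \<le> 2 * real m * D / (R * sin A)"
    using sqdev_u_le_ln ln_D_le by linarith
  also have "\<dots> \<le> 2 * real m * ((real s / (real m * \<rho>0) + real q) * ?d) / (\<rho>0 powr (real s / real m) * a)"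
    using assms D_nonneg is_rho_star_rho_star[OF q s m angle] m
    by (intro frac_le mult_left_mono D_gap_le mult_mono powr_mono2) auto
  finally show u: "sqdev m u \<le> C * ?d"
    by (simp add: C_def)
  have pos: "0 < \<rho>0 ^ q * a / 4"
    using assms by simp
  have "0 < 1 + \<rho> ^ q"
    using rho by (simp add: add_pos_pos)
  \<comment> \<open>This is the origin of the 4 in the lower bound for c.\<close>
  moreover have "(1 + \<rho> ^ q)\<^sup>2 \<le> 2\<^sup>2"
    using rho by (intro power_mono) (auto simp: power_le_one)
  ultimately have "\<rho>0 ^ q * a / 4 \<le> c_const p q \<theta> \<rho>"
    unfolding c_const_def using assms rho sin_A
    by (intro frac_le mult_mono power_mono) auto
  then have "(\<rho>0 ^ q * a / 4)\<^sup>2 \<le> (c_const p q \<theta> \<rho>)\<^sup>2"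
    using pos by (intro power_mono) auto
  then have "sqdev m u / (c_const p q \<theta> \<rho>)\<^sup>2 \<le> C * ?d / (\<rho>0 ^ q * a / 4)\<^sup>2"
    using u zero_less_power[OF pos] sqdev_nonneg[of m u] by (intro frac_le) linarith+
  with sqdev_beta_le show "sqdev m \<beta> \<le> C / (\<rho>0 ^ q * a / 4)\<^sup>2 * ?d"
    by simp
qed

end

section \<open>Uniformity over compact sets of angles and the O-statements\<close>

lemma sin_angA_pos:
  assumes "0 < q" "q < s" "r * int q - p * int s = 1"
    and "\<theta> \<in> {2 * pi * real_of_int p / real q <..< 2 * pi * real_of_int r / real s}"
  shows "0 < sin (angA p q \<theta>)"
proof (rule sin_gt_zero)
  have \<theta>: "2 * pi * real_of_int p < \<theta> * real q" "\<theta> * real s < 2 * pi * real_of_int r"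
    using assms by (auto simp: divide_less_eq less_divide_eq)
  then show "0 < angA p q \<theta>"
    by (simp add: angA_def mult.commute)
  have "real_of_int r * real q - real_of_int p * real s = 1"
    using arg_cong[OF assms(3), of real_of_int] by simp
  then have eq: "2 * pi * real_of_int r * real q = 2 * pi * real_of_int p * real s + 2 * pi"
    by (simp add: algebra_simps)
       (metis (no_types, opaque_lifting) distrib_left mult.commute mult.left_commute mult_1)
  \<comment> \<open>By the determinant relation the interval of angles has length 2 pi / (q s), so s
    A < 2 pi; and s \<ge> 2 because 0 < q < s.\<close>
  have "real s * angA p q \<theta> = \<theta> * real s * real q - 2 * pi * real_of_int p * real s"
    by (simp add: angA_def algebra_simps)
  also have "\<dots> < 2 * pi * real_of_int r * real q - 2 * pi * real_of_int p * real s"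
    using \<theta>(2) assms(1) by simp
  also have "\<dots> = 2 * pi"
    using eq by simp
  also have "\<dots> \<le> real s * pi"
    using assms(1,2) by (intro mult_right_mono) auto
  finally show "angA p q \<theta> < pi"
    using assms(2) by simp
qed

text \<open>The lower bound a is the minimum of sin A on K. K is not assumed to satisfy A + B < pi,
  so positivity of that minimum comes from the interval alone, by
  \<open>sin_angA_pos\<close>.\<close>

lemma sqdev_uniform_compact:
  assumes "0 < q" "0 < s" "0 < m" "q < s" "r * int q - p * int s = 1"
    and "compact K" "K \<subseteq> {2 * pi * real_of_int p / real q <..< 2 * pi * real_of_int r / real s}"
    and "0 < \<rho>0"
  shows "\<exists>C. \<forall>\<theta> \<in> K. \<forall>\<rho> \<beta>.
            \<rho>0 \<le> \<rho> \<and> \<rho> < rho_star p q r s m \<theta> \<and> admissible p q r s m \<theta> \<rho> \<beta> \<longrightarrow>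
              sqdev m (\<lambda>j. u_arg q \<theta> \<rho> (\<beta> j)) \<le> C * (rho_star p q r s m \<theta> - \<rho>)
              \<and> sqdev m \<beta> \<le> C * (rho_star p q r s m \<theta> - \<rho>)"
proof (cases "K = {}")
  case False
  have "continuous_on K (\<lambda>\<theta>. sin (angA p q \<theta>))"
    unfolding angA_def by (intro continuous_intros)
  from continuous_attains_inf[OF assms(6) False this] obtain \<theta>0 where
    \<theta>0: "\<theta>0 \<in> K" "\<And>\<theta>. \<theta> \<in> K \<Longrightarrow> sin (angA p q \<theta>0) \<le> sin (angA p q \<theta>)"
    by blast
  define a where "a = sin (angA p q \<theta>0)"
  have "0 < a"
    unfolding a_def using \<theta>0(1) assms by (intro sin_angA_pos[of q s r p]) auto
  define C where "C = 2 * real m * (real s / (real m * \<rho>0) + real q) / (\<rho>0 powr (real s / real m) * a)"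
  define C' where "C' = C / (\<rho>0 ^ q * a / 4)\<^sup>2"
  show ?thesis
  proof (intro exI[of _ "max C C'"] ballI allI impI)
    fix \<theta> \<rho> \<beta>
    assume "\<theta> \<in> K"
      and H: "\<rho>0 \<le> \<rho> \<and> \<rho> < rho_star p q r s m \<theta> \<and> admissible p q r s m \<theta> \<rho> \<beta>"
    interpret admissible_point p r q s m \<theta> \<rho> \<beta>
      using assms H by unfold_locales auto
    let ?d = "rho_star p q r s m \<theta> - \<rho>"
    have "sqdev m u \<le> C * ?d" "sqdev m \<beta> \<le> C' * ?d"
      using sqdev_uniform[of \<rho>0 a] H assms(8) \<open>0 < a\<close> \<theta>0(2)[OF \<open>\<theta> \<in> K\<close>]
      by (auto simp: C_def C'_def a_def)
    moreover have "C * ?d \<le> max C C' * ?d" "C' * ?d \<le> max C C' * ?d"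
      using H by (auto intro!: mult_right_mono)
    ultimately show "sqdev m u \<le> max C C' * ?d \<and> sqdev m \<beta> \<le> max C C' * ?d"
      by linarith
  qed
qed simp

text \<open>The fixed-angle case is the uniform bound for the compact set {\<theta>}, with half of
  \<open>rho_star\<close> as lower bound for the radius.\<close>

lemma sqdev_bigo:
  assumes "0 < q" "0 < s" "0 < m" "q < s" "r * int q - p * int s = 1"
    and adm: "admissible_angle p q r s m \<theta>"
  shows "(\<lambda>(\<rho>, \<beta>). sqdev m (\<lambda>j. u_arg q \<theta> \<rho> (\<beta> j)))
           \<in> O[below_rho_star p q r s m \<theta>](\<lambda>(\<rho>, \<beta>). rho_star p q r s m \<theta> - \<rho>)"
    and "(\<lambda>(\<rho>, \<beta>). sqdev m \<beta>)
           \<in> O[below_rho_star p q r s m \<theta>](\<lambda>(\<rho>, \<beta>). rho_star p q r s m \<theta> - \<rho>)"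
proof -
  let ?x = "rho_star p q r s m \<theta>"
  have x: "0 < ?x"
    using is_rho_star_rho_star[OF assms(1-3) adm] by (simp add: is_rho_star_def)
  have "\<theta> \<in> {2 * pi * real_of_int p / real q <..< 2 * pi * real_of_int r / real s}"
    using admissible_angle_bounds(1,2)[OF assms(1-3) adm] assms(1-3)
    by (simp add: angA_def angB_def less_divide_eq divide_less_eq mult.commute)
  then obtain C where C: "\<And>\<rho> \<beta>. ?x / 2 \<le> \<rho> \<Longrightarrow> \<rho> < ?x \<Longrightarrow> admissible p q r s m \<theta> \<rho> \<beta> \<Longrightarrow>
      sqdev m (\<lambda>j. u_arg q \<theta> \<rho> (\<beta> j)) \<le> C * (?x - \<rho>) \<and> sqdev m \<beta> \<le> C * (?x - \<rho>)"
    using sqdev_uniform_compact[OF assms(1-5), of "{\<theta>}" "?x / 2"] x by auto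
  have "eventually (\<lambda>\<rho>. \<rho> \<in> {?x / 2<..<?x}) (at_left ?x)"
    using x by (intro eventually_at_left_real) simp
  \<comment> \<open>The left neighbourhood restricts \<rho> only; admissibility of the pair comes
    from the principal part of the filter.\<close>
  then have ev: "eventually (\<lambda>z. fst z \<in> {?x / 2<..<?x} \<and> (\<lambda>(\<rho>, \<beta>). admissible p q r s m \<theta> \<rho> \<beta>) z)
      (below_rho_star p q r s m \<theta>)"
    unfolding below_rho_star_def eventually_inf_principal eventually_filtercomap
    by (intro exI[of _ "\<lambda>\<rho>. \<rho> \<in> {?x / 2<..<?x}"]) auto
  show "(\<lambda>(\<rho>, \<beta>). sqdev m (\<lambda>j. u_arg q \<theta> \<rho> (\<beta> j)))
      \<in> O[below_rho_star p q r s m \<theta>](\<lambda>(\<rho>, \<beta>). ?x - \<rho>)"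
    by (rule bigoI[of _ C], rule eventually_mono[OF ev]) (use C in \<open>auto simp: sqdev_nonneg\<close>)
  show "(\<lambda>(\<rho>, \<beta>). sqdev m \<beta>) \<in> O[below_rho_star p q r s m \<theta>](\<lambda>(\<rho>, \<beta>). ?x - \<rho>)"
    by (rule bigoI[of _ C], rule eventually_mono[OF ev]) (use C in \<open>auto simp: sqdev_nonneg\<close>)
qed

theorem propositionA1:
  fixes p r :: int and q s m :: nat
  assumes "0 < q" and "0 < s" and "0 < m" and "q < s"
    and "r * int q - p * int s = 1"
  shows
    "(\<forall>\<theta> \<rho> \<beta>. admissible p q r s m \<theta> \<rho> \<beta> \<longrightarrow>
       (let A = angA p q \<theta>; B = angB r s m \<theta>; M = M_arg q \<theta> \<rho>;
            u = (\<lambda>j. u_arg q \<theta> \<rho> (\<beta> j)); J = J_gap q m \<theta> \<rho> \<beta>;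
            D = D_gap p q r s m \<theta> \<rho>; c = c_const p q \<theta> \<rho>; R = \<rho> powr (real s / real m)
        in (\<forall>j \<in> {1..m}. 0 < u j \<and> A \<le> u j \<and> u j < M) \<and> M < pi
         \<and> avg m u = A + B \<and> 0 \<le> J \<and> 0 \<le> D
         \<and> J \<ge> 1 / 2 * sqdev m u
         \<and> D = R * sin A * (exp (J / real m) - 1)
         \<and> sqdev m u \<le> 2 * real m * ln (1 + D / (R * sin A))
         \<and> 2 * real m * ln (1 + D / (R * sin A)) \<le> 2 * real m * D / (R * sin A)
         \<and> c > 0
         \<and> sqdev m \<beta> \<le> sqdev m u / c\<^sup>2))
     \<and> (\<forall>\<theta>. admissible_angle p q r s m \<theta> \<longrightarrow>
         (\<exists>!x. is_rho_star p q r s m \<theta> x)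
         \<and> (\<lambda>(\<rho>, \<beta>). sqdev m (\<lambda>j. u_arg q \<theta> \<rho> (\<beta> j)))
             \<in> O[below_rho_star p q r s m \<theta>](\<lambda>(\<rho>, \<beta>). rho_star p q r s m \<theta> - \<rho>)
         \<and> (\<lambda>(\<rho>, \<beta>). sqdev m \<beta>)
             \<in> O[below_rho_star p q r s m \<theta>](\<lambda>(\<rho>, \<beta>). rho_star p q r s m \<theta> - \<rho>))
     \<and> (\<forall>K \<rho>0. compact K
           \<and> K \<subseteq> {2 * pi * real_of_int p / real q <..< 2 * pi * real_of_int r / real s}
           \<and> 0 < \<rho>0 \<longrightarrow>
         (\<exists>C. \<forall>\<theta> \<in> K. \<forall>\<rho> \<beta>.
            \<rho>0 \<le> \<rho> \<and> \<rho> < rho_star p q r s m \<theta> \<and> admissible p q r s m \<theta> \<rho> \<beta> \<longrightarrow>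
              sqdev m (\<lambda>j. u_arg q \<theta> \<rho> (\<beta> j)) \<le> C * (rho_star p q r s m \<theta> - \<rho>)
              \<and> sqdev m \<beta> \<le> C * (rho_star p q r s m \<theta> - \<rho>)))"
proof (intro conjI allI impI)
  fix \<theta> \<rho> \<beta>
  assume "admissible p q r s m \<theta> \<rho> \<beta>"
  then interpret admissible_point p r q s m \<theta> \<rho> \<beta>
    using assms by unfold_locales auto
  show "let A = angA p q \<theta>; B = angB r s m \<theta>; M = M_arg q \<theta> \<rho>;
            u = (\<lambda>j. u_arg q \<theta> \<rho> (\<beta> j)); J = J_gap q m \<theta> \<rho> \<beta>;
            D = D_gap p q r s m \<theta> \<rho>; c = c_const p q \<theta> \<rho>; R = \<rho> powr (real s / real m)
        in (\<forall>j \<in> {1..m}. 0 < u j \<and> A \<le> u j \<and> u j < M) \<and> M < pi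
         \<and> avg m u = A + B \<and> 0 \<le> J \<and> 0 \<le> D
         \<and> J \<ge> 1 / 2 * sqdev m u
         \<and> D = R * sin A * (exp (J / real m) - 1)
         \<and> sqdev m u \<le> 2 * real m * ln (1 + D / (R * sin A))
         \<and> 2 * real m * ln (1 + D / (R * sin A)) \<le> 2 * real m * D / (R * sin A)
         \<and> c > 0
         \<and> sqdev m \<beta> \<le> sqdev m u / c\<^sup>2"
    unfolding Let_def
    by (intro conjI ballI u_bounds M_bounds avg_u J_nonneg D_nonneg J_ge D_eq sqdev_u_le_ln ln_D_le
        c_const_pos sqdev_beta_le)
next
  fix K :: "real set" and \<rho>0 :: real
  assume "compact K
    \<and> K \<subseteq> {2 * pi * real_of_int p / real q <..< 2 * pi * real_of_int r / real s} \<and> 0 < \<rho>0"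
  then show "\<exists>C. \<forall>\<theta> \<in> K. \<forall>\<rho> \<beta>.
            \<rho>0 \<le> \<rho> \<and> \<rho> < rho_star p q r s m \<theta> \<and> admissible p q r s m \<theta> \<rho> \<beta> \<longrightarrow>
              sqdev m (\<lambda>j. u_arg q \<theta> \<rho> (\<beta> j)) \<le> C * (rho_star p q r s m \<theta> - \<rho>)
              \<and> sqdev m \<beta> \<le> C * (rho_star p q r s m \<theta> - \<rho>)"
    using sqdev_uniform_compact[OF assms] by blast
qed (use ex1_is_rho_star[OF assms(1-3)] sqdev_bigo[OF assms] in blast)+

end
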